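(* For all integers $n \geq 3$ and $k \geq 1$ with $2k < n$, the \textbf{rna} number of the generalized Petersen graph $P(n,k)$ satisfies $$3 \leq \sigma^{-}(P(n,k)) \leq n.$$
   Context: For $n \geq 3$, $k \geq 1$ with $2k<n$, the generalized Petersen graph $P(n,k)$ has vertex set $\{u_i, v_i : i=0,1,\dots,n-1\}$ and edge set $\{u_iu_{i+1},\ u_iv_i,\ v_iv_{i+k} : i=0,\dots,n-1\}$, subscripts read modulo $n$. For a simple connected graph $G$ of order $N$, the \textbf{rna} number $\sigma^{-}(G)$ is the minimum, over all bijections $f: V(G)\to\{1,2,\dots,N\}$, of the number of edges $uv$ of $G$ such that $f(u)$ and $f(v)$ have different parity. Equivalently, it is the minimum number of edges between $A$ and $V(G)\setminus A$ over all $A\subseteq V(G)$ with $|A|=\lceil N/2\rceil$. *)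

theory Defs
  imports Main
begin

text \<open>A graph is given by its vertex set and its set of edges, an edge being the two-element
  set of its endpoints.\<close>

definition simple_graph :: "'a set \<Rightarrow> 'a set set \<Rightarrow> bool" where
  "simple_graph V E \<longleftrightarrow> finite V \<and> (\<forall>e\<in>E. e \<subseteq> V \<and> card e = 2)"

definition connected_graph :: "'a set \<Rightarrow> 'a set set \<Rightarrow> bool" where
  "connected_graph V E \<longleftrightarrow>
     V \<noteq> {} \<and> (\<forall>x\<in>V. \<forall>y\<in>V. (x, y) \<in> {(a, b). {a, b} \<in> E}\<^sup>*)"

definition parity_changing_edges :: "'a set set \<Rightarrow> ('a \<Rightarrow> nat) \<Rightarrow> 'a set set" where
  "parity_changing_edges E f = {e \<in> E. \<exists>u v. e = {u, v} \<and> even (f u) \<noteq> even (f v)}"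

text \<open>The infimum is over a set of natural numbers; it is an attained minimum as soon as that set
  is nonempty, i.e. for every finite vertex set (lemma \<open>rna_number_attained\<close>).\<close>

definition rna_number :: "'a set \<Rightarrow> 'a set set \<Rightarrow> nat" where
  "rna_number V E =
     (INF f \<in> {f. bij_betw f V {1..card V}}. card (parity_changing_edges E f))"

lemma rna_number_attained:
  assumes "finite V"
  shows "\<exists>f. bij_betw f V {1..card V} \<and> rna_number V E = card (parity_changing_edges E f)"
proof -
  have "{f. bij_betw f V {1..card V}} \<noteq> {}"
    using finite_same_card_bij[OF assms, of "{1..card V}"] by auto
  then have "rna_number V E \<in>
      (\<lambda>f. card (parity_changing_edges E f)) ` {f. bij_betw f V {1..card V}}"
    unfolding rna_number_def by (intro Inf_nat_def1) simp
  then show ?thesis by auto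
qed

lemma rna_number_le:
  assumes "bij_betw f V {1..card V}"
  shows "rna_number V E \<le> card (parity_changing_edges E f)"
  unfolding rna_number_def using assms by (intro cINF_lower) auto

datatype petersen_vertex = U nat | V nat

definition petersen_verts :: "nat \<Rightarrow> petersen_vertex set" where
  "petersen_verts n = U ` {0..<n} \<union> V ` {0..<n}"

definition petersen_edges :: "nat \<Rightarrow> nat \<Rightarrow> petersen_vertex set set" where
  "petersen_edges n k =
     (\<Union>i\<in>{0..<n}. {{U i, U ((i + 1) mod n)}, {U i, V i}, {V i, V ((i + k) mod n)}})"

lemma finite_petersen_verts: "finite (petersen_verts n)"
  by (simp add: petersen_verts_def)

lemma card_petersen_verts: "card (petersen_verts n) = 2 * n"
  unfolding petersen_verts_def
  by (subst card_Un_disjoint) (auto simp: card_image inj_on_def)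

lemma add_mod_neq:
  fixes i j n :: nat
  assumes "i < n" "0 < j" "j < n"
  shows "(i + j) mod n \<noteq> i"
  using assms by (cases "i + j < n") (auto simp: mod_if)

lemma simple_graph_petersen:
  assumes "n \<ge> 3" "k \<ge> 1" "2 * k < n"
  shows "simple_graph (petersen_verts n) (petersen_edges n k)"
proof -
  have "(i + 1) mod n \<noteq> i" "(i + k) mod n \<noteq> i" if "i < n" for i
    using that assms by (intro add_mod_neq; simp)+
  note neq = this this[symmetric]
  show ?thesis
    unfolding simple_graph_def
  proof (intro conjI ballI)
    fix e assume "e \<in> petersen_edges n k"
    then obtain i where i: "i < n"
      and e: "e = {U i, U ((i + 1) mod n)} \<or> e = {U i, V i} \<or> e = {V i, V ((i + k) mod n)}"
      by (auto simp: petersen_edges_def)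
    show "e \<subseteq> petersen_verts n" using i e by (auto simp: petersen_verts_def)
    show "card e = 2" using e neq[OF i] by (auto simp: card_insert_if)
  qed (rule finite_petersen_verts)
qed

lemma connected_graph_petersen:
  assumes "n \<ge> 3"
  shows "connected_graph (petersen_verts n) (petersen_edges n k)"
proof -
  let ?R = "{(a, b). {a, b} \<in> petersen_edges n k}"
  have sym: "sym (?R\<^sup>*)"
    by (intro sym_rtrancl symI) (simp add: insert_commute)
  have U: "(U 0, U i) \<in> ?R\<^sup>*" if "i < n" for i
    using that
  proof (induction i)
    case (Suc i)
    then have "{U i, U (Suc i)} \<in> petersen_edges n k"
      unfolding petersen_edges_def by (intro UN_I[of i]) auto
    with Suc show ?case by (auto intro: rtrancl_into_rtrancl)
  qed simp
  have V: "(U 0, V i) \<in> ?R\<^sup>*" if "i < n" for i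
  proof -
    have "(U i, V i) \<in> ?R" using that unfolding petersen_edges_def by auto
    with U[OF that] show ?thesis by (rule rtrancl_into_rtrancl)
  qed
  from U V have "(U 0, x) \<in> ?R\<^sup>*" if "x \<in> petersen_verts n" for x
    using that unfolding petersen_verts_def by auto
  with sym have "(x, y) \<in> ?R\<^sup>*" if "x \<in> petersen_verts n" "y \<in> petersen_verts n" for x y
    using that by (meson rtrancl_trans symD)
  moreover have "petersen_verts n \<noteq> {}"
    using assms by (auto simp: petersen_verts_def)
  ultimately show ?thesis unfolding connected_graph_def by blast
qed

end

theory Submission
  imports Defs
begin

text \<open>
  Labelling the outer vertices with the even numbers and the inner ones with the odd numbers makes
  exactly the \<open>n\<close> spokes parity changing, which gives the upper bound.

  For the lower bound, let a labelling be given. If the parity is constant on the outer cycle, the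
  inner vertices all have the other parity, because there are \<open>n\<close> labels of each, and all \<open>n \<ge> 3\<close>
  spokes change parity. Otherwise the outer cycle has an edge from even to odd and one from odd to
  even, so any parity-changing spoke or inner edge is a third one. If there is no such spoke or
  inner edge, the parity pattern of the outer cycle is invariant under the shift by \<open>k\<close>, so a
  parity-changing outer edge at \<open>i\<close> gives two more at \<open>i + k\<close> and \<open>i + 2 k\<close>; these differ modulo
  \<open>n\<close> since \<open>2 k < n\<close>.
\<close>

lemma cyclic_closed_imp_all:
  fixes n a b :: nat
  assumes step: "\<And>i. i < n \<Longrightarrow> P i \<Longrightarrow> P ((i + 1) mod n)"
    and "a < n" "P a" "b < n"
  shows "P b"
proof -
  have "P ((a + m) mod n)" for m
  proof (induction m)
    case 0
    then show ?case using assms by simp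
  next
    case (Suc m)
    then have "P (((a + m) mod n + 1) mod n)" using step assms by simp
    then show ?case by (simp add: mod_Suc_eq)
  qed
  from this[of "n - a + b"] show ?thesis using assms by simp
qed

lemma cyclic_transition:
  fixes n a b :: nat
  assumes "a < n" "P a" "b < n" "\<not> P b"
  obtains i where "i < n" "P i" "\<not> P ((i + 1) mod n)"
  using cyclic_closed_imp_all[of n P a b] assms by blast

lemma card_even_eq_upto_double: "card {m \<in> {1..2 * n}. even m = b} = n"
proof (cases b)
  case True
  have "{m \<in> {1..2 * n}. even m = b} = (\<lambda>i. 2 * i + 2) ` {0..<n}"
  proof (intro equalityI subsetI)
    fix m assume "m \<in> {m \<in> {1..2 * n}. even m = b}"
    then have "m = 2 * (m div 2 - 1) + 2" "m div 2 - 1 < n" using True by auto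
    then show "m \<in> (\<lambda>i. 2 * i + 2) ` {0..<n}" by (metis atLeast0LessThan imageI lessThan_iff)
  qed (use True in auto)
  then show ?thesis by (simp add: card_image inj_on_def)
next
  case False
  have "{m \<in> {1..2 * n}. even m = b} = (\<lambda>i. 2 * i + 1) ` {0..<n}"
  proof (intro equalityI subsetI)
    fix m assume "m \<in> {m \<in> {1..2 * n}. even m = b}"
    then have "m = 2 * (m div 2) + 1" "m div 2 < n" using False by (auto elim!: oddE)
    then show "m \<in> (\<lambda>i. 2 * i + 1) ` {0..<n}" by (metis atLeast0LessThan imageI lessThan_iff)
  qed (use False in auto)
  then show ?thesis by (simp add: card_image inj_on_def)
qed

lemma finite_petersen_edges: "finite (petersen_edges n k)"
  by (simp add: petersen_edges_def)

lemma outer_edge_inj: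
  assumes "n \<ge> 3" "i < n" "j < n"
    and eq: "{U i, U ((i + 1) mod n)} = {U j, U ((j + 1) mod n)}"
  shows "i = j"
proof (rule ccontr)
  assume "i \<noteq> j"
  with eq have "i = (j + 1) mod n" "j = (i + 1) mod n" by (auto simp: doubleton_eq_iff)
  then have "(i + 2) mod n = i" by (metis add.assoc mod_add_left_eq one_add_one)
  with add_mod_neq[of i n 2] assms show False by simp
qed

lemma parity_changing_edgesI:
  "{u, v} \<in> E \<Longrightarrow> even (f u) \<noteq> even (f v) \<Longrightarrow> {u, v} \<in> parity_changing_edges E f"
  unfolding parity_changing_edges_def by blast

lemma petersen_edge_memI:
  assumes "i < n"
  shows "{U i, U ((i + 1) mod n)} \<in> petersen_edges n k"
    and "{U i, V i} \<in> petersen_edges n k"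
    and "{V i, V ((i + k) mod n)} \<in> petersen_edges n k"
  using assms unfolding petersen_edges_def by fastforce+

lemma three_le_card:
  assumes "finite S" "a \<in> S" "b \<in> S" "c \<in> S" "a \<noteq> b" "a \<noteq> c" "b \<noteq> c"
  shows "3 \<le> card S"
  using card_mono[of S "{a, b, c}"] assms by simp

lemma inner_parity_if_outer_parity_constant:
  assumes f: "bij_betw f (petersen_verts n) {1..2 * n}"
    and const: "\<And>i. i < n \<Longrightarrow> even (f (U i)) = b"
    and "i < n"
  shows "even (f (V i)) \<noteq> b"
proof
  assume V: "even (f (V i)) = b"
  let ?B = "{m \<in> {1..2 * n}. even m = b}"
  have inj: "inj_on f (petersen_verts n)" using f by (rule bij_betw_imp_inj_on)
  have range: "f x \<in> {1..2 * n}" if "x \<in> petersen_verts n" for x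
    using f that by (rule bij_betwE[THEN bspec])
  have outer: "U ` {0..<n} \<subseteq> petersen_verts n" by (auto simp: petersen_verts_def)
  have Vi: "V i \<in> petersen_verts n" using \<open>i < n\<close> by (auto simp: petersen_verts_def)
  have "card (f ` U ` {0..<n}) = n"
    using inj_on_subset[OF inj outer] by (simp add: card_image inj_on_def[of U])
  moreover have "f ` U ` {0..<n} \<subseteq> ?B" using const range outer by auto
  ultimately have "f ` U ` {0..<n} = ?B"
    using card_even_eq_upto_double[of n b] by (intro card_subset_eq) simp_all
  then have "f (V i) \<in> f ` U ` {0..<n}" using V range[OF Vi] by simp
  then obtain j where "j < n" "f (V i) = f (U j)" by auto
  then show False using inj_onD[OF inj] Vi outer by fastforce
qed

lemma three_le_card_parity_changing_petersen:
  assumes n: "n \<ge> 3" and k: "k \<ge> 1" "2 * k < n"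
    and f: "bij_betw f (petersen_verts n) {1..2 * n}"
  shows "3 \<le> card (parity_changing_edges (petersen_edges n k) f)" (is "3 \<le> card ?C")
proof -
  have fin: "finite ?C"
    unfolding parity_changing_edges_def using finite_petersen_edges by simp
  let ?p = "\<lambda>i. even (f (U i))" and ?q = "\<lambda>i. even (f (V i))"
  let ?e = "\<lambda>i. {U i, U ((i + 1) mod n)}"
  have outer: "?e i \<in> ?C" if "i < n" "?p i \<noteq> ?p ((i + 1) mod n)" for i
    using that by (intro parity_changing_edgesI petersen_edge_memI)
  have spoke: "{U i, V i} \<in> ?C" if "i < n" "?p i \<noteq> ?q i" for i
    using that by (intro parity_changing_edgesI petersen_edge_memI)
  have inner: "{V i, V ((i + k) mod n)} \<in> ?C" if "i < n" "?q i \<noteq> ?q ((i + k) mod n)" for i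
    using that by (intro parity_changing_edgesI petersen_edge_memI)
  have outer_neq: "?e i \<noteq> ?e j" if "i < n" "j < n" "i \<noteq> j" for i j
    using outer_edge_inj[OF n] that by blast
  show ?thesis
  proof (cases "\<exists>b. \<forall>i<n. ?p i = b")
    case True
    then obtain b where b: "\<And>i. i < n \<Longrightarrow> ?p i = b" by blast
    have "{U i, V i} \<in> ?C" if "i < n" for i
      using spoke inner_parity_if_outer_parity_constant[OF f b that] b that by blast
    then show ?thesis
      using n by (intro three_le_card[OF fin, of "{U 0, V 0}" "{U 1, V 1}" "{U 2, V 2}"])
        (auto simp: doubleton_eq_iff)
  next
    case False
    then obtain a b where ab: "a < n" "?p a" "b < n" "\<not> ?p b" by metis
    obtain i where i: "i < n" "?p i" "\<not> ?p ((i + 1) mod n)"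
      using cyclic_transition[of a n ?p b] ab by blast
    obtain j where j: "j < n" "\<not> ?p j" "?p ((j + 1) mod n)"
      using cyclic_transition[of b n "\<lambda>i. \<not> ?p i" a] ab by blast
    have ij: "?e i \<in> ?C" "?e j \<in> ?C" "?e i \<noteq> ?e j"
      using outer[of i] outer[of j] outer_neq[of i j] i j by auto
    show ?thesis
    proof (cases "\<exists>m<n. ?p m \<noteq> ?q m \<or> ?q m \<noteq> ?q ((m + k) mod n)")
      case True
      then obtain m where "m < n" "?p m \<noteq> ?q m \<or> ?q m \<noteq> ?q ((m + k) mod n)" by blast
      then obtain e where "e \<in> ?C" "e = {U m, V m} \<or> e = {V m, V ((m + k) mod n)}"
        using spoke inner by blast
      then show ?thesis
        using ij by (intro three_le_card[OF fin, of "?e i" "?e j" e])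
          (auto simp: doubleton_eq_iff)
    next
      case False
      then have shift: "?p ((m + k) mod n) = ?p m" if "m < n" for m
        using that n by (metis mod_less_divisor gr_implies_not0 not_gr0)
      define s where "s m = (m + k) mod n" for m
      have s: "s m < n \<and> ?p (s m) \<and> \<not> ?p ((s m + 1) mod n)"
        if m: "m < n" "?p m" "\<not> ?p ((m + 1) mod n)" for m
      proof -
        have "(s m + 1) mod n = ((m + 1) mod n + k) mod n"
          unfolding s_def by (simp add: mod_simps ac_simps)
        then show ?thesis
          using shift[of m] shift[of "(m + 1) mod n"] m by (simp add: s_def)
      qed
      have 1: "s i < n" "?p (s i)" "\<not> ?p ((s i + 1) mod n)" using s[OF i] by auto
      have 2: "s (s i) < n" "?p (s (s i))" "\<not> ?p ((s (s i) + 1) mod n)" using s[OF 1] by auto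
      have "s (s i) = (i + 2 * k) mod n"
        unfolding s_def mult_2 by (simp add: mod_simps add.assoc)
      then have "i \<noteq> s (s i)" using add_mod_neq[of i n "2 * k"] i k by simp
      moreover have "i \<noteq> s i" "s i \<noteq> s (s i)"
        using add_mod_neq[of i n k] add_mod_neq[of "s i" n k] i 1 k by (simp_all add: s_def)
      ultimately show ?thesis
        using i 1 2 by (intro three_le_card[OF fin, of "?e i" "?e (s i)" "?e (s (s i))"]
            outer outer_neq) auto
    qed
  qed
qed

lemma rna_number_petersen_le:
  "rna_number (petersen_verts n) (petersen_edges n k) \<le> n"
proof -
  define f where "f x = (case x of U i \<Rightarrow> 2 * i + 2 | V i \<Rightarrow> 2 * i + 1)" for x
  have inj: "inj_on f (petersen_verts n)"
    unfolding inj_on_def petersen_verts_def f_def by (auto; presburger)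
  have "f ` petersen_verts n = {1..2 * n}"
  proof (rule card_subset_eq)
    show "f ` petersen_verts n \<subseteq> {1..2 * n}"
      unfolding petersen_verts_def f_def by auto
    show "card (f ` petersen_verts n) = card {1..2 * n}"
      using inj by (simp add: card_image card_petersen_verts)
  qed simp
  with inj have "bij_betw f (petersen_verts n) {1..card (petersen_verts n)}"
    by (simp add: bij_betw_def card_petersen_verts)
  then have "rna_number (petersen_verts n) (petersen_edges n k)
      \<le> card (parity_changing_edges (petersen_edges n k) f)"
    by (rule rna_number_le)
  also have "\<dots> \<le> card ((\<lambda>i. {U i, V i}) ` {0..<n})"
  proof (rule card_mono)
    show "parity_changing_edges (petersen_edges n k) f \<subseteq> (\<lambda>i. {U i, V i}) ` {0..<n}"
      unfolding parity_changing_edges_def petersen_edges_def f_def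
      by (auto simp: doubleton_eq_iff)
  qed simp
  also have "\<dots> \<le> n" using card_image_le[of "{0..<n}"] by simp
  finally show ?thesis .
qed

theorem theorem4p2:
  fixes n k :: nat
  assumes "n \<ge> 3" and "k \<ge> 1" and "2 * k < n"
  shows "3 \<le> rna_number (petersen_verts n) (petersen_edges n k) \<and>
         rna_number (petersen_verts n) (petersen_edges n k) \<le> n"
proof
  obtain f where "bij_betw f (petersen_verts n) {1..2 * n}"
    and "rna_number (petersen_verts n) (petersen_edges n k)
      = card (parity_changing_edges (petersen_edges n k) f)"
    using rna_number_attained[OF finite_petersen_verts] by (metis card_petersen_verts)
  then show "3 \<le> rna_number (petersen_verts n) (petersen_edges n k)"
    using three_le_card_parity_changing_petersen assms by simp
  show "rna_number (petersen_verts n) (petersen_edges n k) \<le> n"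
    by (rule rna_number_petersen_le)
qed

end
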